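(* Let $\otimes$ be a continuous t-norm on $[0,1]$. The functor $$C:\mathsf{CompHaus}\longrightarrow\mathsf{Mon}([0,1]\text{-}\mathsf{FinSup})^{\mathrm{op}},$$ sending a compact Hausdorff space $X$ to the set $CX$ of all continuous maps $X\to[0,1]$ with pointwise structure, and a continuous map $f:X\to Y$ to $CY\to CX$, $\psi\mapsto\psi\cdot f$, is fully faithful.
   Context: $\mathsf{CompHaus}$ is the category of compact Hausdorff spaces and continuous maps (viewed as discretely ordered partially ordered compact spaces); $[0,1]$ carries the Euclidean topology. A continuous t-norm is an associative commutative operation $\otimes$ on $[0,1]$ with neutral element $1$, preserving suprema in each variable and continuous for the Euclidean topology. $\hom(u,-)$ is the right adjoint of $u\otimes-$: $u\otimes v\le w\iff v\le\hom(u,w)$. A $[0,1]$-category is a set $X$ with a map $a:X\times X\to[0,1]$ with $a(x,x)=1$ and $a(x,y)\otimes a(y,z)\le a(x,z)$. A $[0,1]$-functor $f:(X,a)\to(Y,b)$ is a map with $a(x,y)\le b(f(x),f(y))$. The natural order is $x\le y\iff a(x,y)=1$; $(X,a)$ is separated if this order is anti-symmetric. A $u$-copower of $x$ is an element $x\otimes u$ with $a(x\otimes u,y)=\hom(u,a(x,y))$ for all $y$. $(X,a)$ is finitely cocomplete if it has all colimits of weighted diagrams with finite underlying set; equivalently, it has all copowers ($u\in[0,1]$), a bottom element, and all binary suprema in the natural order, with $a(x\vee y,z)=a(x,z)\wedge a(y,z)$ for all $z$. A map between finitely cocomplete $[0,1]$-categories is a finitely cocontinuous $[0,1]$-functor iff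 it is monotone and preserves copowers and binary suprema. $[0,1]\text{-}\mathsf{FinSup}$ is the category of separated finitely cocomplete $[0,1]$-categories and finitely cocontinuous $[0,1]$-functors. Objects of $\mathsf{Mon}([0,1]\text{-}\mathsf{FinSup})$ are objects $X$ of $[0,1]\text{-}\mathsf{FinSup}$ with an associative commutative operation $\otimes:X\times X\to X$ whose unit is the top element $1$ of $X$, such that each $x\otimes-:X\to X$ is a finitely cocontinuous $[0,1]$-functor. Morphisms are finitely cocontinuous $[0,1]$-functors preserving the unit and the multiplication. The structure of $CX$ is pointwise: $\vee$, $(\psi\otimes u)(x)=\psi(x)\otimes u$, $(\psi_1\otimes\psi_2)(x)=\psi_1(x)\otimes\psi_2(x)$, constants $0$ and $1$, and $[0,1]$-category structure $d(\psi_1,\psi_2)=\inf_x\hom(\psi_1(x),\psi_2(x))$. *)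

theory Defs
  imports "HOL-Analysis.Analysis" "HOL-Algebra.Group"
begin

section \<open>The unit interval and continuous t-norms\<close>

text \<open>Suprema and infima in the complete lattice \<open>[0,1]\<close>. For a set of reals in the
  unit interval the inserted bound only matters when the set is empty, where the value has to be
  \<open>0\<close> and \<open>1\<close>, respectively.\<close>

definition unit_Sup :: "real set \<Rightarrow> real" where
  "unit_Sup A = Sup (insert 0 A)"

definition unit_Inf :: "real set \<Rightarrow> real" where
  "unit_Inf A = Inf (insert 1 A)"

text \<open>Preservation of suprema includes the empty supremum. By commutativity it is enough to
  require it in the second variable.\<close>

definition continuous_t_norm :: "(real \<Rightarrow> real \<Rightarrow> real) \<Rightarrow> bool" where
  "continuous_t_norm T \<longleftrightarrow>
     (\<forall>u\<in>{0..1}. \<forall>v\<in>{0..1}. T u v \<in> {0..1}) \<and>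
     (\<forall>u\<in>{0..1}. \<forall>v\<in>{0..1}. \<forall>w\<in>{0..1}. T (T u v) w = T u (T v w)) \<and>
     (\<forall>u\<in>{0..1}. \<forall>v\<in>{0..1}. T u v = T v u) \<and>
     (\<forall>u\<in>{0..1}. T 1 u = u) \<and>
     (\<forall>u\<in>{0..1}. \<forall>A\<subseteq>{0..1}. T u (unit_Sup A) = unit_Sup (T u ` A)) \<and>
     continuous_on ({0..1} \<times> {0..1}) (\<lambda>(u, v). T u v)"

definition t_hom :: "(real \<Rightarrow> real \<Rightarrow> real) \<Rightarrow> real \<Rightarrow> real \<Rightarrow> real" where
  "t_hom T u w = unit_Sup {v \<in> {0..1}. T u v \<le> w}"

section \<open>Categories enriched in the unit interval\<close>

definition unit_category :: "(real \<Rightarrow> real \<Rightarrow> real) \<Rightarrow> 'x set \<Rightarrow> ('x \<Rightarrow> 'x \<Rightarrow> real) \<Rightarrow> bool" where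
  "unit_category T X a \<longleftrightarrow>
     (\<forall>x\<in>X. \<forall>y\<in>X. a x y \<in> {0..1}) \<and>
     (\<forall>x\<in>X. a x x = 1) \<and>
     (\<forall>x\<in>X. \<forall>y\<in>X. \<forall>z\<in>X. T (a x y) (a y z) \<le> a x z)"

definition unit_functor ::
  "'x set \<Rightarrow> ('x \<Rightarrow> 'x \<Rightarrow> real) \<Rightarrow> 'y set \<Rightarrow> ('y \<Rightarrow> 'y \<Rightarrow> real) \<Rightarrow> ('x \<Rightarrow> 'y) \<Rightarrow> bool" where
  "unit_functor X a Y b f \<longleftrightarrow>
     f \<in> X \<rightarrow> Y \<and> (\<forall>x\<in>X. \<forall>y\<in>X. a x y \<le> b (f x) (f y))"

definition natural_le :: "('x \<Rightarrow> 'x \<Rightarrow> real) \<Rightarrow> 'x \<Rightarrow> 'x \<Rightarrow> bool" where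
  "natural_le a x y \<longleftrightarrow> a x y = 1"

definition separated :: "'x set \<Rightarrow> ('x \<Rightarrow> 'x \<Rightarrow> real) \<Rightarrow> bool" where
  "separated X a \<longleftrightarrow> (\<forall>x\<in>X. \<forall>y\<in>X. natural_le a x y \<and> natural_le a y x \<longrightarrow> x = y)"

text \<open>A weighted diagram in \<open>(X, a)\<close>: an enriched functor \<open>h\<close> from an enriched category
  \<open>(I, c)\<close> to \<open>(X, a)\<close> together with a weight \<open>w\<close>, that is, an enriched functor from the dual of
  \<open>(I, c)\<close> to the unit interval (equivalently, a distributor from \<open>(I, c)\<close> to the one-point
  category).\<close>

definition weighted_diagram ::
  "(real \<Rightarrow> real \<Rightarrow> real) \<Rightarrow> 'x set \<Rightarrow> ('x \<Rightarrow> 'x \<Rightarrow> real) \<Rightarrow>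
   'i set \<Rightarrow> ('i \<Rightarrow> 'i \<Rightarrow> real) \<Rightarrow> ('i \<Rightarrow> 'x) \<Rightarrow> ('i \<Rightarrow> real) \<Rightarrow> bool" where
  "weighted_diagram T X a I c h w \<longleftrightarrow>
     unit_category T I c \<and> unit_functor I c X a h \<and>
     unit_functor I (\<lambda>i j. c j i) {0..1} (t_hom T) w"

definition is_colimit ::
  "(real \<Rightarrow> real \<Rightarrow> real) \<Rightarrow> 'x set \<Rightarrow> ('x \<Rightarrow> 'x \<Rightarrow> real) \<Rightarrow>
   'i set \<Rightarrow> ('i \<Rightarrow> 'x) \<Rightarrow> ('i \<Rightarrow> real) \<Rightarrow> 'x \<Rightarrow> bool" where
  "is_colimit T X a I h w x \<longleftrightarrow>
     x \<in> X \<and> (\<forall>y\<in>X. a x y = unit_Inf ((\<lambda>i. t_hom T (w i) (a (h i) y)) ` I))"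

text \<open>Every finite diagram is isomorphic to one whose underlying set consists of natural numbers,
  so index sets of type \<open>nat set\<close> suffice.\<close>

definition finitely_cocomplete ::
  "(real \<Rightarrow> real \<Rightarrow> real) \<Rightarrow> 'x set \<Rightarrow> ('x \<Rightarrow> 'x \<Rightarrow> real) \<Rightarrow> bool" where
  "finitely_cocomplete T X a \<longleftrightarrow>
     (\<forall>(I :: nat set) c h w.
        finite I \<and> weighted_diagram T X a I c h w \<longrightarrow> (\<exists>x. is_colimit T X a I h w x))"

definition finitely_cocontinuous ::
  "(real \<Rightarrow> real \<Rightarrow> real) \<Rightarrow> 'x set \<Rightarrow> ('x \<Rightarrow> 'x \<Rightarrow> real) \<Rightarrow>
   'y set \<Rightarrow> ('y \<Rightarrow> 'y \<Rightarrow> real) \<Rightarrow> ('x \<Rightarrow> 'y) \<Rightarrow> bool" where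
  "finitely_cocontinuous T X a Y b f \<longleftrightarrow>
     unit_functor X a Y b f \<and>
     (\<forall>(I :: nat set) c h w x.
        finite I \<and> weighted_diagram T X a I c h w \<and> is_colimit T X a I h w x \<longrightarrow>
        is_colimit T Y b I (f \<circ> h) w (f x))"

definition finsup_object ::
  "(real \<Rightarrow> real \<Rightarrow> real) \<Rightarrow> 'x set \<Rightarrow> ('x \<Rightarrow> 'x \<Rightarrow> real) \<Rightarrow> bool" where
  "finsup_object T X a \<longleftrightarrow>
     unit_category T X a \<and> separated X a \<and> finitely_cocomplete T X a"

section \<open>Monoids in the category of finitely cocomplete enriched categories\<close>

record 'x unit_monoid = "'x monoid" +
  ehom :: "'x \<Rightarrow> 'x \<Rightarrow> real"

definition mon_finsup_object ::
  "(real \<Rightarrow> real \<Rightarrow> real) \<Rightarrow> ('x, 'm) unit_monoid_scheme \<Rightarrow> bool" where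
  "mon_finsup_object T M \<longleftrightarrow>
     finsup_object T (carrier M) (ehom M) \<and>
     comm_monoid M \<and>
     (\<forall>x\<in>carrier M. natural_le (ehom M) x \<one>\<^bsub>M\<^esub>) \<and>
     (\<forall>x\<in>carrier M.
        finitely_cocontinuous T (carrier M) (ehom M) (carrier M) (ehom M) (\<lambda>y. x \<otimes>\<^bsub>M\<^esub> y))"

text \<open>Here and below, maps are normalised outside their domain (\<open>extensional\<close>), so that
  equality of morphisms is equality on the underlying sets.\<close>

definition mon_finsup_hom ::
  "(real \<Rightarrow> real \<Rightarrow> real) \<Rightarrow> ('x, 'm) unit_monoid_scheme \<Rightarrow> ('y, 'n) unit_monoid_scheme \<Rightarrow>
   ('x \<Rightarrow> 'y) set" where
  "mon_finsup_hom T M N =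
     {F \<in> extensional (carrier M).
        finitely_cocontinuous T (carrier M) (ehom M) (carrier N) (ehom N) F \<and>
        F \<in> hom M N \<and> F \<one>\<^bsub>M\<^esub> = \<one>\<^bsub>N\<^esub>}"

section \<open>Compact Hausdorff spaces and the functor C\<close>

definition comphaus_hom :: "'a topology \<Rightarrow> 'b topology \<Rightarrow> ('a \<Rightarrow> 'b) set" where
  "comphaus_hom X Y = {f \<in> extensional (topspace X). continuous_map X Y f}"

definition C_set :: "'a topology \<Rightarrow> ('a \<Rightarrow> real) set" where
  "C_set X = comphaus_hom X (top_of_set {0..1})"

definition C_obj :: "(real \<Rightarrow> real \<Rightarrow> real) \<Rightarrow> 'a topology \<Rightarrow> ('a \<Rightarrow> real) unit_monoid" where
  "C_obj T X =
     \<lparr>carrier = C_set X,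
      mult = (\<lambda>\<psi>1 \<psi>2. \<lambda>x\<in>topspace X. T (\<psi>1 x) (\<psi>2 x)),
      one = (\<lambda>x\<in>topspace X. 1),
      ehom = (\<lambda>\<psi>1 \<psi>2. unit_Inf ((\<lambda>x. t_hom T (\<psi>1 x) (\<psi>2 x)) ` topspace X))\<rparr>"

definition C_map :: "'a topology \<Rightarrow> 'b topology \<Rightarrow> ('a \<Rightarrow> 'b) \<Rightarrow> ('b \<Rightarrow> real) \<Rightarrow> ('a \<Rightarrow> real)" where
  "C_map X Y f = (\<lambda>\<psi>\<in>C_set Y. compose (topspace X) \<psi> f)"

section \<open>Basic properties\<close>

lemma unit_Sup_le_iff:
  assumes "A \<subseteq> {0..1}" "0 \<le> w"
  shows "unit_Sup A \<le> w \<longleftrightarrow> (\<forall>v\<in>A. v \<le> w)"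
proof -
  have "bdd_above (insert 0 A)" using assms by (intro bdd_aboveI[of _ 1]) auto
  then show ?thesis unfolding unit_Sup_def using assms by (subst cSup_le_iff) auto
qed

lemma le_unit_Inf_iff:
  assumes "A \<subseteq> {0..1}" "w \<le> 1"
  shows "w \<le> unit_Inf A \<longleftrightarrow> (\<forall>v\<in>A. w \<le> v)"
proof -
  have "bdd_below (insert 1 A)" using assms by (intro bdd_belowI[of _ 0]) auto
  then show ?thesis unfolding unit_Inf_def using assms by (subst le_cInf_iff) auto
qed

lemma unit_Sup_mem: "A \<subseteq> {0..1} \<Longrightarrow> unit_Sup A \<in> {0..1}"
  using unit_Sup_le_iff[of A 1] unit_Sup_le_iff[of A "unit_Sup A"]
  unfolding unit_Sup_def
  by (auto intro!: cSup_upper bdd_aboveI[of _ 1])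

lemma unit_Inf_mem: "A \<subseteq> {0..1} \<Longrightarrow> unit_Inf A \<in> {0..1}"
  using le_unit_Inf_iff[of A 0]
  unfolding unit_Inf_def
  by (auto intro!: cInf_lower bdd_belowI[of _ 0])

lemma t_hom_mem: "t_hom T u w \<in> {0..1}"
  unfolding t_hom_def by (rule unit_Sup_mem) auto

lemma t_norm_mem:
  assumes "continuous_t_norm T" "u \<in> {0..1}" "v \<in> {0..1}"
  shows "T u v \<in> {0..1}"
proof -
  have "\<forall>u\<in>{0..1}. \<forall>v\<in>{0..1}. T u v \<in> {0..1}"
    using assms(1) unfolding continuous_t_norm_def by (elim conjE)
  from this[rule_format, OF assms(2,3)] show ?thesis .
qed

lemma t_norm_assoc:
  assumes "continuous_t_norm T" "u \<in> {0..1}" "v \<in> {0..1}" "w \<in> {0..1}"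
  shows "T (T u v) w = T u (T v w)"
proof -
  have "\<forall>u\<in>{0..1}. \<forall>v\<in>{0..1}. \<forall>w\<in>{0..1}. T (T u v) w = T u (T v w)"
    using assms(1) unfolding continuous_t_norm_def by (elim conjE)
  from this[rule_format, OF assms(2-4)] show ?thesis .
qed

lemma t_norm_commute:
  assumes "continuous_t_norm T" "u \<in> {0..1}" "v \<in> {0..1}"
  shows "T u v = T v u"
proof -
  have "\<forall>u\<in>{0..1}. \<forall>v\<in>{0..1}. T u v = T v u"
    using assms(1) unfolding continuous_t_norm_def by (elim conjE)
  from this[rule_format, OF assms(2,3)] show ?thesis .
qed

lemma t_norm_Sup:
  assumes "continuous_t_norm T" "u \<in> {0..1}" "A \<subseteq> {0..1}"
  shows "T u (unit_Sup A) = unit_Sup (T u ` A)"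
proof -
  have "\<forall>u\<in>{0..1}. \<forall>A\<subseteq>{0..1}. T u (unit_Sup A) = unit_Sup (T u ` A)"
    using assms(1) unfolding continuous_t_norm_def by (elim conjE)
  from this[rule_format, OF assms(2,3)] show ?thesis .
qed

lemma t_norm_mono:
  assumes T: "continuous_t_norm T" and u: "u \<in> {0..1}" "v \<in> {0..1}" "v' \<in> {0..1}" "v \<le> v'"
  shows "T u v \<le> T u v'"
proof -
  have e: "unit_Sup {v, v'} = v'" unfolding unit_Sup_def using u by (intro cSup_eq_maximum) auto
  have s: "T u ` {v, v'} \<subseteq> {0..1}" using t_norm_mem[OF T] u by auto
  have eq: "T u v' = unit_Sup (T u ` {v, v'})"
    by (rule t_norm_Sup[OF T u(1), of "{v, v'}", unfolded e]) (use u in simp)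
  have "0 \<le> T u v'" using s by simp
  from unit_Sup_le_iff[OF s this] have "\<forall>x\<in>T u ` {v, v'}. x \<le> T u v'"
    by (rule iffD1) (rule eq_refl[OF eq[symmetric]])
  then show ?thesis by (rule bspec) blast
qed

text \<open>\<open>t_hom T u\<close> is right adjoint to \<open>T u\<close>.\<close>

lemma t_hom_adjoint:
  assumes T: "continuous_t_norm T" and u: "u \<in> {0..1}" "v \<in> {0..1}" "w \<in> {0..1}"
  shows "T u v \<le> w \<longleftrightarrow> v \<le> t_hom T u w"
proof
  let ?A = "{v \<in> {0..1}. T u v \<le> w}"
  assume "T u v \<le> w"
  then have "v \<in> insert 0 ?A" using u(2) by blast
  then show "v \<le> t_hom T u w"
    unfolding t_hom_def unit_Sup_def by (rule cSup_upper) (auto intro: bdd_aboveI[of _ 1])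
next
  let ?A = "{v \<in> {0..1}. T u v \<le> w}"
  assume a: "v \<le> t_hom T u w"
  have A: "?A \<subseteq> {0..1}" by blast
  have s: "T u ` ?A \<subseteq> {0..1}" using t_norm_mem[OF T u(1)] by blast
  have "0 \<le> w" using u(3) by simp
  have "T u v \<le> T u (t_hom T u w)" by (rule t_norm_mono[OF T u(1,2) t_hom_mem a])
  also have "\<dots> = unit_Sup (T u ` ?A)"
    unfolding t_hom_def by (rule t_norm_Sup[OF T u(1) A])
  also have "\<dots> \<le> w" unfolding unit_Sup_le_iff[OF s \<open>0 \<le> w\<close>] by blast
  finally show "T u v \<le> w" .
qed

text \<open>Colimits in \<open>C X\<close> are computed pointwise. For a one-element index set this describes
  copowers, for the empty index set the bottom element, and for a two-element index set with
  weights \<open>1\<close> binary suprema.\<close>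

lemma C_obj_pointwise_colimit:
  assumes T: "continuous_t_norm T"
    and h: "\<And>i. i \<in> I \<Longrightarrow> h i \<in> C_set X" and w: "\<And>i. i \<in> I \<Longrightarrow> w i \<in> {0..1}"
    and \<xi>: "\<xi> \<in> C_set X"
    and eq: "\<And>x. x \<in> topspace X \<Longrightarrow> \<xi> x = unit_Sup ((\<lambda>i. T (h i x) (w i)) ` I)"
  shows "is_colimit T (carrier (C_obj T X)) (ehom (C_obj T X)) I h w \<xi>"
proof -
  let ?d = "ehom (C_obj T X)"
  note T_mem = t_norm_mem[OF T] and T_comm = t_norm_commute[OF T]
    and T_assoc = t_norm_assoc[OF T] and T_Sup = t_norm_Sup[OF T]
  have val: "\<psi> x \<in> {0..1}" if "\<psi> \<in> C_set X" "x \<in> topspace X" for \<psi> x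
    using that unfolding C_set_def comphaus_hom_def continuous_map_def by auto
  have d_mem: "?d \<psi> \<zeta> \<in> {0..1}" for \<psi> \<zeta>
    using unit_Inf_mem t_hom_mem by (auto simp: C_obj_def image_subset_iff)
  have d_le: "v \<le> ?d \<psi> \<zeta> \<longleftrightarrow> (\<forall>x\<in>topspace X. T (\<psi> x) v \<le> \<zeta> x)"
    if "v \<in> {0..1}" "\<psi> \<in> C_set X" "\<zeta> \<in> C_set X" for v \<psi> \<zeta>
  proof -
    have s: "(\<lambda>x. t_hom T (\<psi> x) (\<zeta> x)) ` topspace X \<subseteq> {0..1}" using t_hom_mem by blast
    have "v \<le> ?d \<psi> \<zeta> \<longleftrightarrow> (\<forall>x\<in>topspace X. v \<le> t_hom T (\<psi> x) (\<zeta> x))"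
      using le_unit_Inf_iff[OF s, of v] that by (simp add: C_obj_def)
    then show ?thesis using t_hom_adjoint[OF T val[OF that(2)] that(1) val[OF that(3)]] by simp
  qed
  have "?d \<xi> \<zeta> = unit_Inf ((\<lambda>i. t_hom T (w i) (?d (h i) \<zeta>)) ` I)" (is "_ = ?R")
    if \<zeta>: "\<zeta> \<in> C_set X" for \<zeta>
  proof -
    have s: "(\<lambda>i. t_hom T (w i) (?d (h i) \<zeta>)) ` I \<subseteq> {0..1}" using t_hom_mem by blast
    have "v \<le> ?d \<xi> \<zeta> \<longleftrightarrow> v \<le> ?R" if v: "v \<in> {0..1}" for v
    proof -
      have le: "T (\<xi> x) v \<le> \<zeta> x \<longleftrightarrow> (\<forall>i\<in>I. T (h i x) (T (w i) v) \<le> \<zeta> x)"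
        if x: "x \<in> topspace X" for x
      proof -
        let ?S = "(\<lambda>i. T (h i x) (w i)) ` I"
        have S: "?S \<subseteq> {0..1}" using T_mem[OF val[OF h x] w] by blast
        have TS: "T v ` ?S \<subseteq> {0..1}" using T_mem[OF v] S by blast
        have "T (\<xi> x) v = T v (unit_Sup ?S)" using eq[OF x] T_comm[OF unit_Sup_mem[OF S] v] by simp
        also have "\<dots> = unit_Sup (T v ` ?S)" using T_Sup[OF v S] .
        finally have "T (\<xi> x) v \<le> \<zeta> x \<longleftrightarrow> (\<forall>i\<in>I. T v (T (h i x) (w i)) \<le> \<zeta> x)"
          using unit_Sup_le_iff[OF TS, of "\<zeta> x"] val[OF \<zeta> x] by auto
        moreover have "T v (T (h i x) (w i)) = T (h i x) (T (w i) v)" if "i \<in> I" for i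
          using T_comm[OF v T_mem[OF val[OF h[OF that] x] w[OF that]]]
            T_assoc[OF val[OF h[OF that] x] w[OF that] v] by simp
        ultimately show ?thesis by simp
      qed
      have Tw: "T (w i) v \<in> {0..1}" if "i \<in> I" for i using T_mem[OF w[OF that] v] .
      have "v \<le> ?d \<xi> \<zeta> \<longleftrightarrow> (\<forall>i\<in>I. T (w i) v \<le> ?d (h i) \<zeta>)"
        using d_le[OF v \<xi> \<zeta>] le d_le[OF Tw h \<zeta>] by auto
      also have "\<dots> \<longleftrightarrow> (\<forall>i\<in>I. v \<le> t_hom T (w i) (?d (h i) \<zeta>))"
        using t_hom_adjoint[OF T w v d_mem] by (intro ball_cong refl) simp
      also have "\<dots> \<longleftrightarrow> v \<le> ?R" using le_unit_Inf_iff[OF s, of v] v by auto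
      finally show ?thesis .
    qed
    then show ?thesis using d_mem[of \<xi> \<zeta>] unit_Inf_mem[OF s] by (metis order_antisym order_refl)
  qed
  then show ?thesis using \<xi> unfolding is_colimit_def by (simp add: C_obj_def)
qed

end

theory Submission
  imports Defs
begin

text \<open>The essential point is fullness. Let \<open>F\<close> be a morphism from \<open>C Y\<close> to \<open>C X\<close> and fix a point
  \<open>x\<close> of \<open>X\<close>; the functional \<open>\<Phi> \<psi> = F \<psi> x\<close> preserves finite suprema, products and constants.

  Suppose that every \<open>y\<close> had some \<open>\<psi>\<close> with \<open>\<Phi> \<psi> < c < c' < \<psi> y\<close>. With \<open>\<rho>\<close> the piecewise linear
  ramp that vanishes up to \<open>c\<close> and is \<open>1\<close> from \<open>c'\<close> on, \<open>c \<otimes> \<rho> \<psi> \<le> \<psi>\<close>, so \<open>\<Phi> (\<rho> \<psi>) < 1\<close>, although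
  \<open>\<rho> \<psi>\<close> is \<open>1\<close> near \<open>y\<close>. By compactness, finitely many such functions have supremum \<open>1\<close>, which is
  absurd. Hence some \<open>y\<close> satisfies \<open>\<psi> y \<le> \<Phi> \<psi>\<close> for all \<open>\<psi>\<close>.

  If the inequality were strict for some \<open>\<psi>\<close>, choose \<open>\<psi> y < c < c' < \<Phi> \<psi>\<close> and an Urysohn function
  \<open>\<eta>\<close> with \<open>\<eta> y = 1\<close> that vanishes wherever \<open>\<psi> \<ge> c\<close>. Then \<open>\<Phi> \<eta> = 1\<close> and \<open>\<eta> \<otimes> \<rho> \<psi> = 0\<close>, so
  \<open>\<Phi> (\<rho> \<psi>) = 0\<close>; but \<open>\<psi> \<le> c' \<or> \<rho> \<psi>\<close> yields \<open>\<Phi> \<psi> \<le> c'\<close>, a contradiction. So \<open>\<Phi>\<close> is evaluation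
  at \<open>y\<close>, and \<open>x \<mapsto> y\<close> is continuous because \<open>C Y\<close> separates points from closed sets.\<close>

section \<open>Suprema in the unit interval and t-norms\<close>

lemma unit_Sup_empty: "unit_Sup {} = 0"
  by (simp add: unit_Sup_def)

lemma unit_Sup_singleton: "0 \<le> a \<Longrightarrow> unit_Sup {a} = a"
  unfolding unit_Sup_def by (intro cSup_eq_maximum) auto

lemma unit_Sup_insert:
  assumes "finite A"
  shows "unit_Sup (insert a A) = max a (unit_Sup A)"
  using assms unfolding unit_Sup_def by (simp add: cSup_eq_Max insert_commute[of 0 a])

text \<open>A finite supremum is a maximum, here over \<open>insert 0 A\<close>. This serves to pass
  from a supremum of function values back to a single function.\<close>

lemma unit_Sup_finite_mem: "finite A \<Longrightarrow> unit_Sup A \<in> insert 0 A"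
  unfolding unit_Sup_def by (metis Max_in cSup_eq_Max finite_insert insert_not_empty)

lemma t_norm_one_left:
  assumes "continuous_t_norm T" "u \<in> {0..1}"
  shows "T 1 u = u"
proof -
  have "\<forall>u\<in>{0..1}. T 1 u = u"
    using assms(1) unfolding continuous_t_norm_def by (elim conjE)
  then show ?thesis using assms(2) by blast
qed

lemma t_norm_one_right:
  assumes "continuous_t_norm T" "u \<in> {0..1}"
  shows "T u 1 = u"
  using t_norm_one_left[OF assms] t_norm_commute[OF assms(1) assms(2), of 1] by simp

text \<open>The empty supremum is 0, and \<open>T u\<close> preserves it.\<close>

lemma t_norm_zero_right:
  assumes "continuous_t_norm T" "u \<in> {0..1}"
  shows "T u 0 = 0"
  using t_norm_Sup[OF assms, of "{}"] by (simp add: unit_Sup_empty)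

lemma t_norm_zero_left:
  assumes "continuous_t_norm T" "u \<in> {0..1}"
  shows "T 0 u = 0"
  using t_norm_zero_right[OF assms] t_norm_commute[OF assms(1) assms(2), of 0] by simp

lemma t_norm_mono_left:
  assumes "continuous_t_norm T" "u \<in> {0..1}" "u' \<in> {0..1}" "v \<in> {0..1}" "u \<le> u'"
  shows "T u v \<le> T u' v"
  using t_norm_mono[OF assms(1,4,2,3,5)] t_norm_commute[OF assms(1)] assms by metis

lemma t_norm_le_right:
  assumes "continuous_t_norm T" "u \<in> {0..1}" "v \<in> {0..1}"
  shows "T u v \<le> v"
  using t_norm_mono_left[OF assms(1,2) _ assms(3), of 1] t_norm_one_left[OF assms(1,3)] assms
  by simp

lemma t_norm_le_left:
  assumes "continuous_t_norm T" "u \<in> {0..1}" "v \<in> {0..1}"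
  shows "T u v \<le> u"
  using t_norm_le_right[OF assms(1,3,2)] t_norm_commute[OF assms] by simp

lemma t_hom_self:
  assumes "continuous_t_norm T" "u \<in> {0..1}"
  shows "t_hom T u u = 1"
  using t_hom_adjoint[OF assms, of 1 u] t_norm_one_right[OF assms] t_hom_mem[of T u u] assms(2)
  by auto

lemma continuous_on_t_norm:
  assumes "continuous_t_norm T"
  shows "continuous_on ({0..1} \<times> {0..1}) (\<lambda>(u, v). T u v)"
  using assms unfolding continuous_t_norm_def by (elim conjE)

section \<open>Continuous functions into the unit interval\<close>

text \<open>Continuity into the subspace [0,1] is split into continuity as a real function and a
  range condition, so that facts about real-valued continuous maps apply.\<close>

lemma C_set_iff:
  "\<psi> \<in> C_set X \<longleftrightarrow>
     \<psi> \<in> extensional (topspace X) \<and> continuous_map X euclideanreal \<psi> \<and> \<psi> \<in> topspace X \<rightarrow> {0..1}"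
  unfolding C_set_def comphaus_hom_def by (auto simp: continuous_map_in_subtopology)

lemma C_set_mem: "\<psi> \<in> C_set X \<Longrightarrow> x \<in> topspace X \<Longrightarrow> \<psi> x \<in> {0..1}"
  unfolding C_set_iff by blast

lemma C_set_restrictI:
  assumes "continuous_map X euclideanreal f" "\<And>x. x \<in> topspace X \<Longrightarrow> f x \<in> {0..1}"
  shows "(\<lambda>x\<in>topspace X. f x) \<in> C_set X"
  unfolding C_set_iff using assms by (auto intro: continuous_map_eq[OF assms(1)])

lemma C_set_eqI:
  assumes "\<psi> \<in> C_set X" "\<eta> \<in> C_set X" "\<And>x. x \<in> topspace X \<Longrightarrow> \<psi> x = \<eta> x"
  shows "\<psi> = \<eta>"
  using assms unfolding C_set_iff by (blast intro: extensionalityI)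

lemma C_set_const: "c \<in> {0..1} \<Longrightarrow> (\<lambda>x\<in>topspace X. c) \<in> C_set X"
  by (rule C_set_restrictI) auto

lemma C_set_T:
  assumes T: "continuous_t_norm T" and "\<psi> \<in> C_set X" "\<eta> \<in> C_set X"
  shows "(\<lambda>x\<in>topspace X. T (\<psi> x) (\<eta> x)) \<in> C_set X"
proof (rule C_set_restrictI)
  \<comment> \<open>\<open>T\<close> is known to be continuous only on the unit square, so the
    pairing has to be continuous into that subspace before the two maps are composed.\<close>
  have "continuous_map X (prod_topology (top_of_set {0..1}) (top_of_set {0..1})) (\<lambda>x. (\<psi> x, \<eta> x))"
    using assms(2,3) unfolding C_set_def comphaus_hom_def by (intro continuous_map_pairedI) auto
  then have "continuous_map X (top_of_set ({0..1} \<times> {0..1})) (\<lambda>x. (\<psi> x, \<eta> x))"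
    by (simp only: prod_topology_subtopology_eu)
  moreover have "continuous_map (top_of_set ({0..1} \<times> {0..1})) euclideanreal (\<lambda>(u, v). T u v)"
    using continuous_on_t_norm[OF T] by simp
  ultimately have "continuous_map X euclideanreal ((\<lambda>(u, v). T u v) \<circ> (\<lambda>x. (\<psi> x, \<eta> x)))"
    by (rule continuous_map_compose)
  then show "continuous_map X euclideanreal (\<lambda>x. T (\<psi> x) (\<eta> x))" by (simp add: o_def)
qed (rule t_norm_mem[OF T C_set_mem[OF assms(2)] C_set_mem[OF assms(3)]])

lemma C_set_unit_Sup:
  assumes "finite I" "\<And>i. i \<in> I \<Longrightarrow> h i \<in> C_set X"
  shows "(\<lambda>x\<in>topspace X. unit_Sup ((\<lambda>i. h i x) ` I)) \<in> C_set X"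
proof (rule C_set_restrictI)
  show "continuous_map X euclideanreal (\<lambda>x. unit_Sup ((\<lambda>i. h i x) ` I))"
    using assms
  proof (induction I rule: finite_induct)
    case (insert i I)
    then have "continuous_map X euclideanreal (\<lambda>x. max (h i x) (unit_Sup ((\<lambda>i. h i x) ` I)))"
      by (auto intro!: continuous_map_real_max simp: C_set_iff)
    then show ?case using insert.hyps by (simp add: unit_Sup_insert)
  qed (simp add: unit_Sup_empty)
  show "unit_Sup ((\<lambda>i. h i x) ` I) \<in> {0..1}" if "x \<in> topspace X" for x
    by (intro unit_Sup_mem image_subsetI C_set_mem[OF assms(2) that])
qed

text \<open>A form of Urysohn's lemma: a compact Hausdorff space is normal, hence completely
  regular.\<close>

lemma C_set_separates:
  assumes "compact_space Y" "Hausdorff_space Y" "openin Y U" "y \<in> U"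
  obtains \<eta> where "\<eta> \<in> C_set Y" "\<eta> y = 1" "\<And>z. z \<in> topspace Y \<Longrightarrow> z \<notin> U \<Longrightarrow> \<eta> z = 0"
proof -
  have "normal_space Y" using assms compact_Hausdorff_or_regular_imp_normal_space by blast
  then have "completely_regular_space Y"
    using assms(2) Hausdorff_imp_t1_space normal_imp_completely_regular_space_A by blast
  moreover have "closedin Y (topspace Y - U)" "y \<in> topspace Y - (topspace Y - U)"
    using assms openin_subset by (auto simp: closedin_def)
  ultimately obtain f where f: "continuous_map Y (top_of_set {0..1::real}) f" "f y = 0"
      "f ` (topspace Y - U) \<subseteq> {1}"
    unfolding completely_regular_space_def by metis
  \<comment> \<open>The function \<open>f\<close> is 0 at \<open>y\<close> and 1 off
    \<open>U\<close>, so it is reflected.\<close>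
  have "(\<lambda>z\<in>topspace Y. 1 - f z) \<in> C_set Y"
    using f(1) by (intro C_set_restrictI continuous_map_diff)
      (auto simp: continuous_map_in_subtopology)
  moreover have "y \<in> topspace Y" using assms openin_subset by blast
  ultimately show ?thesis using f that[of "\<lambda>z\<in>topspace Y. 1 - f z"] by auto
qed

definition ramp :: "real \<Rightarrow> real \<Rightarrow> real \<Rightarrow> real" where
  "ramp c c' v = max 0 (min 1 ((v - c) / (c' - c)))"

lemma ramp_mem: "ramp c c' v \<in> {0..1}"
  by (simp add: ramp_def)

lemma ramp_eq_0: "c < c' \<Longrightarrow> v \<le> c \<Longrightarrow> ramp c c' v = 0"
  by (simp add: ramp_def divide_simps)

lemma ramp_eq_1: "c < c' \<Longrightarrow> c' \<le> v \<Longrightarrow> ramp c c' v = 1"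
  by (simp add: ramp_def divide_simps)

lemma C_set_ramp:
  assumes "c < c'" "\<psi> \<in> C_set X"
  shows "(\<lambda>x\<in>topspace X. ramp c c' (\<psi> x)) \<in> C_set X"
proof (rule C_set_restrictI)
  have "continuous_map X euclideanreal \<psi>" using assms(2) by (simp add: C_set_iff)
  moreover have "continuous_on UNIV (ramp c c')"
    unfolding ramp_def using assms(1) by (intro continuous_intros) auto
  ultimately have "continuous_map X euclideanreal (ramp c c' \<circ> \<psi>)"
    by (intro continuous_map_compose[of X euclideanreal \<psi>]) auto
  then show "continuous_map X euclideanreal (\<lambda>x. ramp c c' (\<psi> x))" by (simp add: o_def)
qed (rule ramp_mem)

section \<open>The monoid of continuous functions\<close>

lemma C_obj_simps [simp]:
  "carrier (C_obj T X) = C_set X"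
  "mult (C_obj T X) \<psi> \<eta> = (\<lambda>x\<in>topspace X. T (\<psi> x) (\<eta> x))"
  "one (C_obj T X) = (\<lambda>x\<in>topspace X. 1)"
  by (simp_all add: C_obj_def)

lemma ehom_C_obj_mem: "ehom (C_obj T X) \<psi> \<eta> \<in> {0..1}"
  using unit_Inf_mem[of "(\<lambda>x. t_hom T (\<psi> x) (\<eta> x)) ` topspace X"] t_hom_mem
  by (auto simp: C_obj_def image_subset_iff)

text \<open>The adjunction, applied at each point, replaces the infimum of residuals by inequalities
  between values. The estimates for the enriched structure below go through this form.\<close>

lemma le_ehom_C_obj_iff:
  assumes T: "continuous_t_norm T" and "v \<in> {0..1}" "\<psi> \<in> C_set X" "\<eta> \<in> C_set X"
  shows "v \<le> ehom (C_obj T X) \<psi> \<eta> \<longleftrightarrow> (\<forall>x\<in>topspace X. T (\<psi> x) v \<le> \<eta> x)"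
proof -
  have s: "(\<lambda>x. t_hom T (\<psi> x) (\<eta> x)) ` topspace X \<subseteq> {0..1}" using t_hom_mem by blast
  show ?thesis
    using le_unit_Inf_iff[OF s, of v] assms(2)
      t_hom_adjoint[OF T C_set_mem[OF assms(3)] assms(2) C_set_mem[OF assms(4)]]
    by (simp add: C_obj_def)
qed

lemma natural_le_C_obj_iff:
  assumes T: "continuous_t_norm T" and \<psi>: "\<psi> \<in> C_set X" and \<eta>: "\<eta> \<in> C_set X"
  shows "natural_le (ehom (C_obj T X)) \<psi> \<eta> \<longleftrightarrow> (\<forall>x\<in>topspace X. \<psi> x \<le> \<eta> x)"
proof -
  have "natural_le (ehom (C_obj T X)) \<psi> \<eta> \<longleftrightarrow> 1 \<le> ehom (C_obj T X) \<psi> \<eta>"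
    using ehom_C_obj_mem[of T X \<psi> \<eta>] by (auto simp: natural_le_def)
  also have "\<dots> \<longleftrightarrow> (\<forall>x\<in>topspace X. \<psi> x \<le> \<eta> x)"
    using le_ehom_C_obj_iff[OF T _ \<psi> \<eta>, of 1] t_norm_one_right[OF T C_set_mem[OF \<psi>]] by simp
  finally show ?thesis .
qed

lemma unit_category_C_obj:
  assumes T: "continuous_t_norm T"
  shows "unit_category T (C_set X) (ehom (C_obj T X))"
proof -
  let ?d = "ehom (C_obj T X)"
  have "?d \<psi> \<psi> = 1" if "\<psi> \<in> C_set X" for \<psi>
    using natural_le_C_obj_iff[OF T that that] by (simp add: natural_le_def)
  moreover have "T (?d \<psi> \<eta>) (?d \<eta> \<zeta>) \<le> ?d \<psi> \<zeta>"
    if C: "\<psi> \<in> C_set X" "\<eta> \<in> C_set X" "\<zeta> \<in> C_set X" for \<psi> \<eta> \<zeta>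
  proof -
    note d = ehom_C_obj_mem[of T X]
    \<comment> \<open>After reassociation, the first hom carries \<open>\<psi> x\<close> below
      \<open>\<eta> x\<close>, and the second carries that below \<open>\<zeta> x\<close>.\<close>
    have "T (\<psi> x) (T (?d \<psi> \<eta>) (?d \<eta> \<zeta>)) \<le> \<zeta> x" if x: "x \<in> topspace X" for x
    proof -
      note m = C(1)[THEN C_set_mem, OF x] C(2)[THEN C_set_mem, OF x]
      have "T (\<psi> x) (T (?d \<psi> \<eta>) (?d \<eta> \<zeta>)) = T (T (\<psi> x) (?d \<psi> \<eta>)) (?d \<eta> \<zeta>)"
        by (simp only: t_norm_assoc[OF T m(1) d d])
      also have "\<dots> \<le> T (\<eta> x) (?d \<eta> \<zeta>)"
        using le_ehom_C_obj_iff[OF T d C(1,2), of \<psi> \<eta>] x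
        by (intro t_norm_mono_left[OF T t_norm_mem[OF T m(1) d] m(2) d]) auto
      also have "\<dots> \<le> \<zeta> x"
        using le_ehom_C_obj_iff[OF T d C(2,3), of \<eta> \<zeta>] x by auto
      finally show ?thesis .
    qed
    then show ?thesis using le_ehom_C_obj_iff[OF T t_norm_mem[OF T d d] C(1,3)] by blast
  qed
  ultimately show ?thesis unfolding unit_category_def using ehom_C_obj_mem by blast
qed

lemma separated_C_obj:
  assumes T: "continuous_t_norm T"
  shows "separated (C_set X) (ehom (C_obj T X))"
  unfolding separated_def
proof (intro ballI impI)
  fix \<psi> \<eta> assume C: "\<psi> \<in> C_set X" "\<eta> \<in> C_set X"
    and "natural_le (ehom (C_obj T X)) \<psi> \<eta> \<and> natural_le (ehom (C_obj T X)) \<eta> \<psi>"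
  then have "\<psi> x = \<eta> x" if "x \<in> topspace X" for x
    using that by (simp add: natural_le_C_obj_iff[OF T] order_antisym)
  then show "\<psi> = \<eta>" by (rule C_set_eqI[OF C])
qed

lemma comm_monoid_C_obj:
  assumes T: "continuous_t_norm T"
  shows "comm_monoid (C_obj T X)"
proof (rule comm_monoidI)
  fix \<psi> \<eta> \<zeta> assume "\<psi> \<in> carrier (C_obj T X)" "\<eta> \<in> carrier (C_obj T X)" "\<zeta> \<in> carrier (C_obj T X)"
  then have C: "\<psi> \<in> C_set X" "\<eta> \<in> C_set X" "\<zeta> \<in> C_set X" by simp_all
  show "\<psi> \<otimes>\<^bsub>C_obj T X\<^esub> \<eta> \<in> carrier (C_obj T X)" using C_set_T[OF T C(1,2)] by simp
  show "(\<psi> \<otimes>\<^bsub>C_obj T X\<^esub> \<eta>) \<otimes>\<^bsub>C_obj T X\<^esub> \<zeta> = \<psi> \<otimes>\<^bsub>C_obj T X\<^esub> (\<eta> \<otimes>\<^bsub>C_obj T X\<^esub> \<zeta>)"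
    using t_norm_assoc[OF T C(1)[THEN C_set_mem] C(2)[THEN C_set_mem] C(3)[THEN C_set_mem]]
    by (auto intro!: restrict_ext)
  show "\<psi> \<otimes>\<^bsub>C_obj T X\<^esub> \<eta> = \<eta> \<otimes>\<^bsub>C_obj T X\<^esub> \<psi>"
    using t_norm_commute[OF T C(1)[THEN C_set_mem] C(2)[THEN C_set_mem]]
    by (auto intro!: restrict_ext)
next
  show "\<one>\<^bsub>C_obj T X\<^esub> \<in> carrier (C_obj T X)" using C_set_const[of 1 X] by simp
next
  fix \<psi> assume "\<psi> \<in> carrier (C_obj T X)"
  then have C: "\<psi> \<in> C_set X" by simp
  show "\<one>\<^bsub>C_obj T X\<^esub> \<otimes>\<^bsub>C_obj T X\<^esub> \<psi> = \<psi>"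
    using C t_norm_one_left[OF T C_set_mem[OF C]]
    by (intro extensionalityI[of _ "topspace X"]) (auto simp: C_set_iff)
qed

section \<open>Finite colimits of continuous functions\<close>

lemma C_set_weighted_Sup:
  assumes T: "continuous_t_norm T" and I: "finite I"
    and h: "\<And>i. i \<in> I \<Longrightarrow> h i \<in> C_set X" and w: "\<And>i. i \<in> I \<Longrightarrow> w i \<in> {0..1}"
  shows "(\<lambda>x\<in>topspace X. unit_Sup ((\<lambda>i. T (h i x) (w i)) ` I)) \<in> C_set X"
proof -
  \<comment> \<open>A weight is read as a constant function, so that a copower becomes a pointwise
    product of two continuous functions.\<close>
  let ?g = "\<lambda>i. \<lambda>x\<in>topspace X. T (h i x) ((\<lambda>x\<in>topspace X. w i) x)"
  have "?g i \<in> C_set X" if "i \<in> I" for i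
    by (rule C_set_T[OF T h[OF that] C_set_const[OF w[OF that]]])
  then have "(\<lambda>x\<in>topspace X. unit_Sup ((\<lambda>i. ?g i x) ` I)) \<in> C_set X"
    by (rule C_set_unit_Sup[OF I])
  also have "(\<lambda>x\<in>topspace X. unit_Sup ((\<lambda>i. ?g i x) ` I)) =
      (\<lambda>x\<in>topspace X. unit_Sup ((\<lambda>i. T (h i x) (w i)) ` I))"
    by (rule restrict_ext) simp
  finally show ?thesis .
qed

text \<open>The pointwise supremum is a colimit. Two colimits have the same homs into every
  function, so separatedness identifies them. Preservation of colimits thereby becomes an
  equation.\<close>

lemma is_colimit_C_obj_iff:
  assumes T: "continuous_t_norm T" and I: "finite I"
    and h: "\<And>i. i \<in> I \<Longrightarrow> h i \<in> C_set X" and w: "\<And>i. i \<in> I \<Longrightarrow> w i \<in> {0..1}"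
  shows "is_colimit T (C_set X) (ehom (C_obj T X)) I h w \<xi> \<longleftrightarrow>
    \<xi> = (\<lambda>x\<in>topspace X. unit_Sup ((\<lambda>i. T (h i x) (w i)) ` I))"
proof -
  let ?d = "ehom (C_obj T X)"
  define \<sigma> where "\<sigma> = (\<lambda>x\<in>topspace X. unit_Sup ((\<lambda>i. T (h i x) (w i)) ` I))"
  have \<sigma>: "\<sigma> \<in> C_set X"
    unfolding \<sigma>_def using C_set_weighted_Sup[where h = h and w = w, OF T I h w] .
  have c: "is_colimit T (C_set X) ?d I h w \<sigma>"
    using C_obj_pointwise_colimit[where h = h and w = w, OF T h w \<sigma>] by (simp add: \<sigma>_def)
  have "\<xi> = \<sigma>" if "is_colimit T (C_set X) ?d I h w \<xi>"
  proof -
    have \<xi>: "\<xi> \<in> C_set X" using that by (simp add: is_colimit_def)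
    have eq: "?d \<xi> \<eta> = ?d \<sigma> \<eta>" if "\<eta> \<in> C_set X" for \<eta>
      using \<open>is_colimit T (C_set X) ?d I h w \<xi>\<close> c that by (simp add: is_colimit_def)
    have "natural_le ?d \<xi> \<sigma>" "natural_le ?d \<sigma> \<xi>"
      using eq[OF \<sigma>] eq[OF \<xi>] unit_category_C_obj[OF T, of X] \<sigma> \<xi>
      by (auto simp: natural_le_def unit_category_def)
    then show ?thesis using separated_C_obj[OF T, of X] \<sigma> \<xi> unfolding separated_def by blast
  qed
  then show ?thesis using c unfolding \<sigma>_def by blast
qed

lemma weighted_diagram_C_objD:
  assumes "weighted_diagram T (C_set X) (ehom (C_obj T X)) I c h w" "i \<in> I"
  shows "h i \<in> C_set X" "w i \<in> {0..1}"
  using assms unfolding weighted_diagram_def unit_functor_def by blast+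

lemma finsup_object_C_obj:
  assumes T: "continuous_t_norm T"
  shows "finsup_object T (C_set X) (ehom (C_obj T X))"
  unfolding finsup_object_def finitely_cocomplete_def
proof (intro conjI allI impI)
  show "unit_category T (C_set X) (ehom (C_obj T X))" by (rule unit_category_C_obj[OF T])
  show "separated (C_set X) (ehom (C_obj T X))" by (rule separated_C_obj[OF T])
next
  fix I :: "nat set" and c h w
  assume "finite I \<and> weighted_diagram T (C_set X) (ehom (C_obj T X)) I c h w"
  then have I: "finite I" and D: "weighted_diagram T (C_set X) (ehom (C_obj T X)) I c h w"
    by simp_all
  show "\<exists>\<xi>. is_colimit T (C_set X) (ehom (C_obj T X)) I h w \<xi>"
    using is_colimit_C_obj_iff[where h = h and w = w,
        OF T I weighted_diagram_C_objD(1)[OF D] weighted_diagram_C_objD(2)[OF D]] by blast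
qed

text \<open>Colimits in both categories are the unique pointwise ones, so functoriality and one
  equation for finite weighted families suffice.\<close>

lemma finitely_cocontinuous_C_objI:
  assumes T: "continuous_t_norm T"
    and F: "unit_functor (C_set Y) (ehom (C_obj T Y)) (C_set X) (ehom (C_obj T X)) F"
    and sup: "\<And>(I :: nat set) h w. finite I \<Longrightarrow> (\<And>i. i \<in> I \<Longrightarrow> h i \<in> C_set Y) \<Longrightarrow>
      (\<And>i. i \<in> I \<Longrightarrow> w i \<in> {0..1}) \<Longrightarrow>
      F (\<lambda>y\<in>topspace Y. unit_Sup ((\<lambda>i. T (h i y) (w i)) ` I)) =
      (\<lambda>x\<in>topspace X. unit_Sup ((\<lambda>i. T (F (h i) x) (w i)) ` I))"
  shows "finitely_cocontinuous T (C_set Y) (ehom (C_obj T Y)) (C_set X) (ehom (C_obj T X)) F"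
  unfolding finitely_cocontinuous_def
proof (intro conjI allI impI F)
  fix I :: "nat set" and c h w \<xi>
  assume a: "finite I \<and> weighted_diagram T (C_set Y) (ehom (C_obj T Y)) I c h w \<and>
    is_colimit T (C_set Y) (ehom (C_obj T Y)) I h w \<xi>"
  then have I: "finite I" and D: "weighted_diagram T (C_set Y) (ehom (C_obj T Y)) I c h w"
    by simp_all
  note h = weighted_diagram_C_objD(1)[OF D] and w = weighted_diagram_C_objD(2)[OF D]
  have Fh: "(F \<circ> h) i \<in> C_set X" if "i \<in> I" for i
    using F h[OF that] by (auto simp: unit_functor_def)
  have "\<xi> = (\<lambda>y\<in>topspace Y. unit_Sup ((\<lambda>i. T (h i y) (w i)) ` I))"
    using a is_colimit_C_obj_iff[where h = h and w = w, OF T I h w] by blast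
  then have "F \<xi> = (\<lambda>x\<in>topspace X. unit_Sup ((\<lambda>i. T ((F \<circ> h) i x) (w i)) ` I))"
    using sup[where h = h and w = w, OF I h w] by simp
  then show "is_colimit T (C_set X) (ehom (C_obj T X)) I (F \<circ> h) w (F \<xi>)"
    using is_colimit_C_obj_iff[where h = "F \<circ> h" and w = w, OF T I Fh w] by blast
qed

text \<open>Every finite family with arbitrary weights is a diagram over a discrete index category,
  so cocontinuity yields the equation for all such families.\<close>

lemma finitely_cocontinuous_C_objD:
  fixes I :: "nat set"
  assumes T: "continuous_t_norm T"
    and F: "finitely_cocontinuous T (C_set Y) (ehom (C_obj T Y)) (C_set X) (ehom (C_obj T X)) F"
    and I: "finite I" and h: "\<And>i. i \<in> I \<Longrightarrow> h i \<in> C_set Y" and w: "\<And>i. i \<in> I \<Longrightarrow> w i \<in> {0..1}"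
  shows "F (\<lambda>y\<in>topspace Y. unit_Sup ((\<lambda>i. T (h i y) (w i)) ` I)) =
      (\<lambda>x\<in>topspace X. unit_Sup ((\<lambda>i. T (F (h i) x) (w i)) ` I))"
proof -
  \<comment> \<open>The discrete category on \<open>I\<close>: for distinct indices the functor
    inequalities read 0 \<le> a hom, and on the diagonal they follow from reflexivity.\<close>
  let ?c = "\<lambda>i j. if i = j then 1 else 0 :: real"
  let ?\<xi> = "\<lambda>y\<in>topspace Y. unit_Sup ((\<lambda>i. T (h i y) (w i)) ` I)"
  have "unit_category T I ?c"
    unfolding unit_category_def
    using t_norm_one_left[OF T, of 1] t_norm_zero_left[OF T, of 1] t_norm_zero_left[OF T, of 0]
      t_norm_zero_right[OF T, of 1] by auto
  moreover have "unit_functor I ?c (C_set Y) (ehom (C_obj T Y)) h"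
    unfolding unit_functor_def
    using h ehom_C_obj_mem[of T Y] unit_category_C_obj[OF T, of Y] by (auto simp: unit_category_def)
  moreover have "unit_functor I (\<lambda>i j. ?c j i) {0..1} (t_hom T) w"
    unfolding unit_functor_def using w t_hom_mem[of T] t_hom_self[OF T] by auto
  ultimately have "weighted_diagram T (C_set Y) (ehom (C_obj T Y)) I ?c h w"
    by (simp add: weighted_diagram_def)
  moreover have "is_colimit T (C_set Y) (ehom (C_obj T Y)) I h w ?\<xi>"
    using is_colimit_C_obj_iff[where h = h and w = w, OF T I h w] by blast
  ultimately have "is_colimit T (C_set X) (ehom (C_obj T X)) I (F \<circ> h) w (F ?\<xi>)"
    using F I unfolding finitely_cocontinuous_def by blast
  moreover have Fh: "(F \<circ> h) i \<in> C_set X" if "i \<in> I" for i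
    using F h[OF that] by (auto simp: finitely_cocontinuous_def unit_functor_def)
  ultimately show ?thesis
    using is_colimit_C_obj_iff[where h = "F \<circ> h" and w = w, OF T I Fh w] by simp
qed

text \<open>\<open>T (\<eta> x)\<close> preserves suprema, and associativity moves it past the
  weights. Functoriality follows by multiplying the pointwise inequalities that characterise the hom
  by \<open>\<eta> x\<close>.\<close>

lemma finitely_cocontinuous_C_obj_mult:
  assumes T: "continuous_t_norm T" and \<eta>: "\<eta> \<in> C_set X"
  shows "finitely_cocontinuous T (C_set X) (ehom (C_obj T X)) (C_set X) (ehom (C_obj T X))
    (\<lambda>\<psi>. \<lambda>x\<in>topspace X. T (\<eta> x) (\<psi> x))"
proof (rule finitely_cocontinuous_C_objI[OF T])
  let ?M = "\<lambda>\<psi>. \<lambda>x\<in>topspace X. T (\<eta> x) (\<psi> x)" and ?d = "ehom (C_obj T X)"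
  have "?d \<psi> \<zeta> \<le> ?d (?M \<psi>) (?M \<zeta>)" if C: "\<psi> \<in> C_set X" "\<zeta> \<in> C_set X" for \<psi> \<zeta>
  proof -
    note d = ehom_C_obj_mem[of T X \<psi> \<zeta>]
    have "T (?M \<psi> x) (?d \<psi> \<zeta>) \<le> ?M \<zeta> x" if x: "x \<in> topspace X" for x
    proof -
      note m = C_set_mem[OF \<eta> x] C(1)[THEN C_set_mem, OF x] C(2)[THEN C_set_mem, OF x]
      have "T (\<psi> x) (?d \<psi> \<zeta>) \<le> \<zeta> x" using le_ehom_C_obj_iff[OF T d C] x by auto
      then have "T (\<eta> x) (T (\<psi> x) (?d \<psi> \<zeta>)) \<le> T (\<eta> x) (\<zeta> x)"
        by (rule t_norm_mono[OF T m(1) t_norm_mem[OF T m(2) d] m(3)])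
      then show ?thesis using t_norm_assoc[OF T m(1,2) d] x by simp
    qed
    then show ?thesis
      using le_ehom_C_obj_iff[OF T d C_set_T[OF T \<eta> C(1)] C_set_T[OF T \<eta> C(2)]] by blast
  qed
  then show "unit_functor (C_set X) ?d (C_set X) ?d ?M"
    unfolding unit_functor_def using C_set_T[OF T \<eta>] by blast
next
  fix I :: "nat set" and h and w :: "nat \<Rightarrow> real"
  assume h: "\<And>i. i \<in> I \<Longrightarrow> h i \<in> C_set X" and w: "\<And>i. i \<in> I \<Longrightarrow> w i \<in> {0..1}"
  show "(\<lambda>x\<in>topspace X. T (\<eta> x) ((\<lambda>y\<in>topspace X. unit_Sup ((\<lambda>i. T (h i y) (w i)) ` I)) x)) =
      (\<lambda>x\<in>topspace X. unit_Sup ((\<lambda>i. T ((\<lambda>x\<in>topspace X. T (\<eta> x) (h i x)) x) (w i)) ` I))"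
  proof (rule restrict_ext)
    fix x assume x: "x \<in> topspace X"
    have s: "(\<lambda>i. T (h i x) (w i)) ` I \<subseteq> {0..1}"
      using t_norm_mem[OF T C_set_mem[OF h x] w] by blast
    have "T (\<eta> x) ` (\<lambda>i. T (h i x) (w i)) ` I = (\<lambda>i. T (T (\<eta> x) (h i x)) (w i)) ` I"
      unfolding image_image
      by (rule image_cong[OF refl]) (simp only: t_norm_assoc[OF T C_set_mem[OF \<eta> x] C_set_mem[OF h x] w])
    then show "T (\<eta> x) ((\<lambda>y\<in>topspace X. unit_Sup ((\<lambda>i. T (h i y) (w i)) ` I)) x) =
        unit_Sup ((\<lambda>i. T ((\<lambda>x\<in>topspace X. T (\<eta> x) (h i x)) x) (w i)) ` I)"
      using t_norm_Sup[OF T C_set_mem[OF \<eta> x] s] x by simp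
  qed
qed

lemma mon_finsup_object_C_obj:
  assumes T: "continuous_t_norm T"
  shows "mon_finsup_object T (C_obj T X)"
  unfolding mon_finsup_object_def C_obj_simps
proof (intro conjI ballI)
  show "finsup_object T (C_set X) (ehom (C_obj T X))" by (rule finsup_object_C_obj[OF T])
  show "comm_monoid (C_obj T X)" by (rule comm_monoid_C_obj[OF T])
next
  fix \<eta> assume \<eta>: "\<eta> \<in> C_set X"
  have one: "(\<lambda>x\<in>topspace X. 1) \<in> C_set X" by (rule C_set_const) simp
  show "natural_le (ehom (C_obj T X)) \<eta> (\<lambda>x\<in>topspace X. 1)"
    unfolding natural_le_C_obj_iff[OF T \<eta> one] using C_set_mem[OF \<eta>] by simp
  show "finitely_cocontinuous T (C_set X) (ehom (C_obj T X)) (C_set X) (ehom (C_obj T X))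
      (\<lambda>\<psi>. \<lambda>x\<in>topspace X. T (\<eta> x) (\<psi> x))"
    by (rule finitely_cocontinuous_C_obj_mult[OF T \<eta>])
qed

section \<open>Functoriality\<close>

lemma comphaus_hom_compose:
  assumes "f \<in> comphaus_hom X Y" "g \<in> comphaus_hom Y Z"
  shows "compose (topspace X) g f \<in> comphaus_hom X Z"
proof -
  have "continuous_map X Z (g \<circ> f)"
    using assms continuous_map_compose unfolding comphaus_hom_def by blast
  then have "continuous_map X Z (compose (topspace X) g f)"
    by (rule continuous_map_eq) (simp add: compose_def)
  then show ?thesis by (simp add: comphaus_hom_def)
qed

lemma comphaus_hom_mem: "f \<in> comphaus_hom X Y \<Longrightarrow> x \<in> topspace X \<Longrightarrow> f x \<in> topspace Y"
  by (auto simp: comphaus_hom_def continuous_map_def)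

lemma C_map_mem: "f \<in> comphaus_hom X Y \<Longrightarrow> \<psi> \<in> C_set Y \<Longrightarrow> C_map X Y f \<psi> \<in> C_set X"
  using comphaus_hom_compose by (auto simp: C_map_def C_set_def)

lemma C_map_apply: "\<psi> \<in> C_set Y \<Longrightarrow> x \<in> topspace X \<Longrightarrow> C_map X Y f \<psi> x = \<psi> (f x)"
  by (simp add: C_map_def compose_def)

lemma C_map_hom:
  assumes T: "continuous_t_norm T" and f: "f \<in> comphaus_hom X Y"
  shows "C_map X Y f \<in> mon_finsup_hom T (C_obj T Y) (C_obj T X)"
proof -
  note fx = comphaus_hom_mem[OF f] and mem = C_map_mem[OF f] and app = C_map_apply[of _ Y _ X f]
  have mult: "C_map X Y f (\<lambda>y\<in>topspace Y. T (\<psi> y) (\<eta> y)) =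
      (\<lambda>x\<in>topspace X. T (C_map X Y f \<psi> x) (C_map X Y f \<eta> x))"
    if "\<psi> \<in> C_set Y" "\<eta> \<in> C_set Y" for \<psi> \<eta>
    using that C_set_T[OF T that] C_set_T[OF T mem[OF that(1)] mem[OF that(2)]]
    by (intro C_set_eqI[of _ X]) (auto simp: mem app fx)
  have one: "C_map X Y f (\<lambda>y\<in>topspace Y. 1) = (\<lambda>x\<in>topspace X. 1)"
    using C_set_const[of 1 Y] C_set_const[of 1 X]
    by (intro C_set_eqI[of _ X]) (auto simp: mem app fx)
  have "finitely_cocontinuous T (C_set Y) (ehom (C_obj T Y)) (C_set X) (ehom (C_obj T X)) (C_map X Y f)"
  proof (rule finitely_cocontinuous_C_objI[OF T])
    \<comment> \<open>The inequalities that hold at all points of \<open>Y\<close> hold in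
      particular at the points \<open>f x\<close>.\<close>
    have "ehom (C_obj T Y) \<psi> \<eta> \<le> ehom (C_obj T X) (C_map X Y f \<psi>) (C_map X Y f \<eta>)"
      if C: "\<psi> \<in> C_set Y" "\<eta> \<in> C_set Y" for \<psi> \<eta>
      using le_ehom_C_obj_iff[OF T ehom_C_obj_mem C, of T Y \<psi> \<eta>]
        le_ehom_C_obj_iff[OF T ehom_C_obj_mem mem[OF C(1)] mem[OF C(2)], of T Y \<psi> \<eta>]
      by (simp add: app C fx)
    then show "unit_functor (C_set Y) (ehom (C_obj T Y)) (C_set X) (ehom (C_obj T X)) (C_map X Y f)"
      unfolding unit_functor_def using mem by blast
  next
    fix I :: "nat set" and h and w :: "nat \<Rightarrow> real"
    assume I: "finite I" and h: "\<And>i. i \<in> I \<Longrightarrow> h i \<in> C_set Y" and w: "\<And>i. i \<in> I \<Longrightarrow> w i \<in> {0..1}"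
    let ?\<xi> = "\<lambda>y\<in>topspace Y. unit_Sup ((\<lambda>i. T (h i y) (w i)) ` I)"
    have \<xi>: "?\<xi> \<in> C_set Y"
      using C_set_weighted_Sup[where h = h and w = w, OF T I h w] .
    have "C_map X Y f ?\<xi> = (\<lambda>x\<in>topspace X. ?\<xi> (f x))"
      using \<xi> by (simp add: C_map_def compose_def)
    also have "\<dots> = (\<lambda>x\<in>topspace X. unit_Sup ((\<lambda>i. T (C_map X Y f (h i) x) (w i)) ` I))"
      by (rule restrict_ext) (simp add: fx app h cong: image_cong)
    finally show "C_map X Y f ?\<xi> = (\<lambda>x\<in>topspace X. unit_Sup ((\<lambda>i. T (C_map X Y f (h i) x) (w i)) ` I))" .
  qed
  moreover have "C_map X Y f \<in> extensional (C_set Y)" by (simp add: C_map_def)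
  ultimately show ?thesis
    using mult one mem unfolding mon_finsup_hom_def hom_def by simp
qed

lemma C_map_id: "C_map X X (\<lambda>x\<in>topspace X. x) = (\<lambda>\<psi>\<in>C_set X. \<psi>)"
  unfolding C_map_def
proof (rule restrict_ext)
  fix \<psi> assume "\<psi> \<in> C_set X"
  then show "compose (topspace X) \<psi> (\<lambda>x\<in>topspace X. x) = \<psi>"
    by (intro extensionalityI[of _ "topspace X"]) (auto simp: C_set_iff compose_def)
qed

lemma C_map_compose:
  assumes f: "f \<in> comphaus_hom X Y" and g: "g \<in> comphaus_hom Y Z"
  shows "C_map X Z (compose (topspace X) g f) = compose (C_set Z) (C_map X Y f) (C_map Y Z g)"
proof (rule extensionalityI[of _ "C_set Z"])
  fix \<psi> assume \<psi>: "\<psi> \<in> C_set Z"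
  have "C_map X Z (compose (topspace X) g f) \<psi> = C_map X Y f (C_map Y Z g \<psi>)"
    by (rule C_set_eqI[OF C_map_mem[OF comphaus_hom_compose[OF f g] \<psi>] C_map_mem[OF f C_map_mem[OF g \<psi>]]])
      (simp add: C_map_apply \<psi> C_map_mem[OF g \<psi>] comphaus_hom_mem[OF f] compose_eq)
  then show "C_map X Z (compose (topspace X) g f) \<psi> = compose (C_set Z) (C_map X Y f) (C_map Y Z g) \<psi>"
    using \<psi> by (simp add: compose_eq)
qed (auto simp: C_map_def)

text \<open>If \<open>f x\<close> and \<open>g x\<close> differ, an Urysohn function that is 1 at
  \<open>f x\<close> and 0 at \<open>g x\<close> is sent to different functions by the two
  maps.\<close>

lemma C_map_inj:
  assumes Y: "compact_space Y" "Hausdorff_space Y"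
    and f: "f \<in> comphaus_hom X Y" and g: "g \<in> comphaus_hom X Y" and eq: "C_map X Y f = C_map X Y g"
  shows "f = g"
proof (rule extensionalityI[of _ "topspace X"])
  show "f \<in> extensional (topspace X)" "g \<in> extensional (topspace X)"
    using f g by (auto simp: comphaus_hom_def)
  fix x assume x: "x \<in> topspace X"
  show "f x = g x"
  proof (rule ccontr)
    assume "f x \<noteq> g x"
    moreover have "openin Y (topspace Y - {g x})"
      using closedin_Hausdorff_singleton[OF Y(2) comphaus_hom_mem[OF g x]] by (simp add: closedin_def)
    ultimately obtain \<eta> where \<eta>: "\<eta> \<in> C_set Y" "\<eta> (f x) = 1"
        "\<And>z. z \<in> topspace Y \<Longrightarrow> z \<notin> topspace Y - {g x} \<Longrightarrow> \<eta> z = 0"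
      using C_set_separates[OF Y, of _ "f x"] comphaus_hom_mem[OF f x] by (metis DiffI singletonD)
    have "\<eta> (f x) = \<eta> (g x)" using eq C_map_apply[OF \<eta>(1) x] by metis
    then show False using \<eta>(2) \<eta>(3)[OF comphaus_hom_mem[OF g x]] by simp
  qed
qed

section \<open>Functionals on the continuous functions\<close>

text \<open>Since [0,1] is totally ordered, a finite supremum is one of its terms; preservation of
  finite suprema can therefore be phrased as domination by a single member of \<open>S\<close>. The
  alternative 0 covers the empty family.\<close>

lemma functional_is_evaluation:
  assumes T: "continuous_t_norm T" and Y: "compact_space Y" "Hausdorff_space Y"
    and range: "\<And>\<psi>. \<psi> \<in> C_set Y \<Longrightarrow> \<Phi> \<psi> \<in> {0..1}"
    and const: "\<And>c. c \<in> {0..1} \<Longrightarrow> \<Phi> (\<lambda>y\<in>topspace Y. c) = c"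
    and mult: "\<And>\<psi> \<eta>. \<psi> \<in> C_set Y \<Longrightarrow> \<eta> \<in> C_set Y \<Longrightarrow>
      \<Phi> (\<lambda>y\<in>topspace Y. T (\<psi> y) (\<eta> y)) = T (\<Phi> \<psi>) (\<Phi> \<eta>)"
    and sup: "\<And>S \<xi>. finite S \<Longrightarrow> S \<subseteq> C_set Y \<Longrightarrow> \<xi> \<in> C_set Y \<Longrightarrow>
      (\<And>y. y \<in> topspace Y \<Longrightarrow> \<xi> y = 0 \<or> (\<exists>\<eta>\<in>S. \<xi> y \<le> \<eta> y)) \<Longrightarrow> \<Phi> \<xi> = 0 \<or> (\<exists>\<eta>\<in>S. \<Phi> \<xi> \<le> \<Phi> \<eta>)"
  obtains y where "y \<in> topspace Y" "\<And>\<psi>. \<psi> \<in> C_set Y \<Longrightarrow> \<Phi> \<psi> = \<psi> y"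
proof -
  have mono: "\<Phi> \<xi> \<le> \<Phi> \<eta>" if "\<xi> \<in> C_set Y" "\<eta> \<in> C_set Y" "\<And>y. y \<in> topspace Y \<Longrightarrow> \<xi> y \<le> \<eta> y" for \<xi> \<eta>
    using sup[of "{\<eta>}" \<xi>] that range[of \<eta>] by auto
  \<comment> \<open>Open sets on which some function with functional value below 1 is constantly 1.
    If they cover \<open>Y\<close>, compactness contradicts the value 1 at the constant 1.\<close>
  define \<U> where "\<U> = {U. openin Y U \<and> (\<exists>\<eta>\<in>C_set Y. \<Phi> \<eta> < 1 \<and> (\<forall>z\<in>U. \<eta> z = 1))}"
  have "\<exists>y\<in>topspace Y. \<forall>\<psi>\<in>C_set Y. \<psi> y \<le> \<Phi> \<psi>"
  proof (rule ccontr)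
    assume neg: "\<not> (\<exists>y\<in>topspace Y. \<forall>\<psi>\<in>C_set Y. \<psi> y \<le> \<Phi> \<psi>)"
    have "\<exists>U\<in>\<U>. y \<in> U" if y: "y \<in> topspace Y" for y
    proof -
      obtain \<psi> where \<psi>: "\<psi> \<in> C_set Y" "\<Phi> \<psi> < \<psi> y" using neg y by force
      \<comment> \<open>That \<open>c'\<close> lies below \<open>\<psi> y\<close> makes the ramp
        equal to 1 on a neighbourhood of \<open>y\<close>; that \<open>c\<close> lies above
        \<open>\<Phi> \<psi>\<close> keeps the final inequality strict.\<close>
      obtain c' where c': "\<Phi> \<psi> < c'" "c' < \<psi> y" using dense[OF \<psi>(2)] by blast
      obtain c where c: "\<Phi> \<psi> < c" "c < c'" using dense[OF c'(1)] by blast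
      have c01: "c \<in> {0..1}" using c c' range[OF \<psi>(1)] C_set_mem[OF \<psi>(1) y] by auto
      let ?\<eta> = "\<lambda>z\<in>topspace Y. ramp c c' (\<psi> z)" and ?U = "{z \<in> topspace Y. \<psi> z \<in> {c'<..}}"
      have \<eta>: "?\<eta> \<in> C_set Y" by (rule C_set_ramp[OF c(2) \<psi>(1)])
      have "T c (\<Phi> ?\<eta>) = \<Phi> (\<lambda>z\<in>topspace Y. T ((\<lambda>y\<in>topspace Y. c) z) (?\<eta> z))"
        using mult[OF C_set_const[OF c01] \<eta>] const[OF c01] by simp
      also have "\<dots> \<le> \<Phi> \<psi>"
      proof (rule mono[OF C_set_T[OF T C_set_const[OF c01] \<eta>] \<psi>(1)])
        fix z assume z: "z \<in> topspace Y"
        \<comment> \<open>Where \<open>\<psi> z \<le> c\<close> the ramp vanishes; elsewhere the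
          factor \<open>c\<close> is itself below \<open>\<psi> z\<close>.\<close>
        have "T c (ramp c c' (\<psi> z)) \<le> \<psi> z"
        proof (cases "\<psi> z \<le> c")
          case True
          then show ?thesis using ramp_eq_0[OF c(2)] t_norm_zero_right[OF T c01] C_set_mem[OF \<psi>(1) z] by simp
        next
          case False
          then show ?thesis using t_norm_le_left[OF T c01 ramp_mem] by (meson le_cases order_trans)
        qed
        then show "(\<lambda>z\<in>topspace Y. T ((\<lambda>y\<in>topspace Y. c) z) (?\<eta> z)) z \<le> \<psi> z" using z by simp
      qed
      \<comment> \<open>The value 1 would give
        \<open>c = T c 1 \<le> \<Phi> \<psi> < c\<close>.\<close>
      finally have "\<Phi> ?\<eta> \<noteq> 1" using c(1) t_norm_one_right[OF T c01] by auto
      then have "\<Phi> ?\<eta> < 1" using range[OF \<eta>] by auto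
      moreover have "\<forall>z\<in>?U. ?\<eta> z = 1" using ramp_eq_1[OF c(2)] by auto
      moreover have "openin Y ?U"
        by (rule openin_continuous_map_preimage[of Y euclideanreal])
          (use \<psi>(1) in \<open>auto simp: C_set_iff\<close>)
      ultimately have "?U \<in> \<U>" using \<eta> unfolding \<U>_def mem_Collect_eq by (intro conjI bexI[of _ ?\<eta>])
      moreover have "y \<in> ?U" using y c'(2) by simp
      ultimately show ?thesis by (rule bexI[rotated])
    qed
    then have cover: "topspace Y \<subseteq> \<Union>\<U>" by (intro subsetI) (simp only: Union_iff)
    have "\<forall>U\<in>\<U>. openin Y U" by (simp add: \<U>_def)
    then obtain \<F> where \<F>: "finite \<F>" "\<F> \<subseteq> \<U>" "topspace Y \<subseteq> \<Union>\<F>"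
      using Y(1) cover unfolding compact_space_alt by meson
    have "\<forall>U\<in>\<F>. \<exists>\<eta>. \<eta> \<in> C_set Y \<and> \<Phi> \<eta> < 1 \<and> (\<forall>z\<in>U. \<eta> z = 1)"
      using \<F>(2) unfolding \<U>_def by blast
    then obtain g where g: "\<forall>U\<in>\<F>. g U \<in> C_set Y \<and> \<Phi> (g U) < 1 \<and> (\<forall>z\<in>U. g U z = 1)"
      by metis
    let ?one = "\<lambda>y\<in>topspace Y. 1 :: real"
    \<comment> \<open>Both alternatives are absurd: the functional is 1 at the constant 1 and below
      1 at each \<open>g U\<close>.\<close>
    have "\<Phi> ?one = 0 \<or> (\<exists>\<eta>\<in>g ` \<F>. \<Phi> ?one \<le> \<Phi> \<eta>)"
    proof (rule sup)
      fix y assume y: "y \<in> topspace Y"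
      then obtain U where "U \<in> \<F>" "y \<in> U" using \<F>(3) by blast
      then show "?one y = 0 \<or> (\<exists>\<eta>\<in>g ` \<F>. ?one y \<le> \<eta> y)" using g y by force
    qed (use \<F>(1) g C_set_const[of 1 Y] in auto)
    then show False using const[of 1] g by force
  qed
  then obtain y where y: "y \<in> topspace Y" and le: "\<And>\<psi>. \<psi> \<in> C_set Y \<Longrightarrow> \<psi> y \<le> \<Phi> \<psi>" by blast
  have "\<Phi> \<psi> = \<psi> y" if \<psi>: "\<psi> \<in> C_set Y" for \<psi>
  proof (rule ccontr)
    assume "\<Phi> \<psi> \<noteq> \<psi> y"
    then have "\<psi> y < \<Phi> \<psi>" using le[OF \<psi>] by simp
    then obtain c' where c': "\<psi> y < c'" "c' < \<Phi> \<psi>" using dense by blast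
    obtain c where c: "\<psi> y < c" "c < c'" using dense[OF c'(1)] by blast
    have c01: "c' \<in> {0..1}" using c c' range[OF \<psi>] C_set_mem[OF \<psi> y] by auto
    let ?r = "\<lambda>z\<in>topspace Y. ramp c c' (\<psi> z)" and ?U = "{z \<in> topspace Y. \<psi> z \<in> {..<c}}"
    have r: "?r \<in> C_set Y" by (rule C_set_ramp[OF c(2) \<psi>])
    have U: "openin Y ?U"
      by (rule openin_continuous_map_preimage[of Y euclideanreal])
        (use \<psi> in \<open>auto simp: C_set_iff\<close>)
    have yU: "y \<in> ?U" using y c(1) by simp
    obtain \<eta> where \<eta>: "\<eta> \<in> C_set Y" "\<eta> y = 1" "\<And>z. z \<in> topspace Y \<Longrightarrow> z \<notin> ?U \<Longrightarrow> \<eta> z = 0"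
      by (rule C_set_separates[OF Y U yU]) blast
    \<comment> \<open>Here the inequality already proved for \<open>y\<close> is used:
      \<open>1 = \<eta> y \<le> \<Phi> \<eta>\<close>.\<close>
    have one: "\<Phi> \<eta> = 1" using le[OF \<eta>(1)] \<eta>(2) range[OF \<eta>(1)] by simp
    have "T (\<eta> z) (?r z) = 0" if z: "z \<in> topspace Y" for z
    proof (cases "\<psi> z < c")
      case True
      then show ?thesis using ramp_eq_0[OF c(2)] t_norm_zero_right[OF T C_set_mem[OF \<eta>(1) z]] z by simp
    next
      case False
      then show ?thesis using \<eta>(3)[OF z] t_norm_zero_left[OF T ramp_mem] z by simp
    qed
    then have "(\<lambda>z\<in>topspace Y. T (\<eta> z) (?r z)) = (\<lambda>z\<in>topspace Y. 0)" by (intro restrict_ext)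
    then have "T (\<Phi> \<eta>) (\<Phi> ?r) = 0" using mult[OF \<eta>(1) r] const[of 0] by simp
    then have "\<Phi> ?r = 0" using one t_norm_one_left[OF T range[OF r]] by simp
    \<comment> \<open>Where \<open>\<psi>\<close> exceeds \<open>c'\<close> the ramp is 1, so
      \<open>\<psi>\<close> lies below the supremum of the ramp and the constant \<open>c'\<close>.
      The possible bounds for \<open>\<Phi> \<psi>\<close> are then 0 and \<open>c'\<close>, both
      less than \<open>\<Phi> \<psi>\<close>.\<close>
    moreover have "\<Phi> \<psi> = 0 \<or> (\<exists>\<eta>\<in>{?r, \<lambda>z\<in>topspace Y. c'}. \<Phi> \<psi> \<le> \<Phi> \<eta>)"
    proof (rule sup)
      fix z assume z: "z \<in> topspace Y"
      show "\<psi> z = 0 \<or> (\<exists>\<eta>\<in>{?r, \<lambda>z\<in>topspace Y. c'}. \<psi> z \<le> \<eta> z)"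
        using ramp_eq_1[OF c(2), of "\<psi> z"] C_set_mem[OF \<psi> z] z by force
    qed (use r \<psi> C_set_const[OF c01] in auto)
    ultimately show False using const[OF c01] c' c01 by auto
  qed
  then show ?thesis using that y by blast
qed

text \<open>For each \<open>x\<close> the functional sending \<open>\<psi>\<close> to
  \<open>F \<psi> x\<close> is evaluation at some point of \<open>Y\<close>; these points assemble
  into the required map.\<close>

lemma C_hom_eq_C_map:
  assumes T: "continuous_t_norm T" and Y: "compact_space Y" "Hausdorff_space Y"
    and F: "F \<in> mon_finsup_hom T (C_obj T Y) (C_obj T X)"
  obtains f where "f \<in> comphaus_hom X Y" "F = C_map X Y f"
proof -
  have ext: "F \<in> extensional (C_set Y)"
    and coc: "finitely_cocontinuous T (C_set Y) (ehom (C_obj T Y)) (C_set X) (ehom (C_obj T X)) F"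
    and one: "F (\<lambda>y\<in>topspace Y. 1) = (\<lambda>x\<in>topspace X. 1)"
    and mem: "\<And>\<psi>. \<psi> \<in> C_set Y \<Longrightarrow> F \<psi> \<in> C_set X"
    and mult: "\<And>\<psi> \<eta>. \<psi> \<in> C_set Y \<Longrightarrow> \<eta> \<in> C_set Y \<Longrightarrow>
      F (\<lambda>y\<in>topspace Y. T (\<psi> y) (\<eta> y)) = (\<lambda>x\<in>topspace X. T (F \<psi> x) (F \<eta> x))"
    using F unfolding mon_finsup_hom_def hom_def by auto
  note col = finitely_cocontinuous_C_objD[OF T coc]
  have mono: "F \<psi> x \<le> F \<eta> x"
    if "\<psi> \<in> C_set Y" "\<eta> \<in> C_set Y" "\<And>y. y \<in> topspace Y \<Longrightarrow> \<psi> y \<le> \<eta> y" "x \<in> topspace X" for \<psi> \<eta> x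
  proof -
    have "1 = ehom (C_obj T Y) \<psi> \<eta>"
      using natural_le_C_obj_iff[OF T that(1,2)] that(3) by (simp add: natural_le_def)
    also have "\<dots> \<le> ehom (C_obj T X) (F \<psi>) (F \<eta>)"
      using coc that(1,2) by (simp add: finitely_cocontinuous_def unit_functor_def)
    finally have "natural_le (ehom (C_obj T X)) (F \<psi>) (F \<eta>)"
      using ehom_C_obj_mem[of T X "F \<psi>" "F \<eta>"] by (simp add: natural_le_def)
    then show ?thesis using natural_le_C_obj_iff[OF T mem[OF that(1)] mem[OF that(2)]] that(4) by blast
  qed
  \<comment> \<open>A constant \<open>c\<close> is the \<open>c\<close>-copower of the unit, that
    is, a colimit over one index with weight \<open>c\<close>, and \<open>F\<close> preserves the
    unit.\<close>
  have const: "F (\<lambda>y\<in>topspace Y. c) x = c" if c: "c \<in> {0..1}" and x: "x \<in> topspace X" for c x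
    using col[of "{0}" "\<lambda>_. \<lambda>y\<in>topspace Y. 1" "\<lambda>_. c"] C_set_const[of 1 Y] c x one
      t_norm_one_left[OF T c]
    by (simp add: unit_Sup_singleton cong: restrict_cong)
  have sup: "F \<xi> x = 0 \<or> (\<exists>\<eta>\<in>S. F \<xi> x \<le> F \<eta> x)"
    if S: "finite S" "S \<subseteq> C_set Y" and \<xi>: "\<xi> \<in> C_set Y" and x: "x \<in> topspace X"
      and le: "\<And>y. y \<in> topspace Y \<Longrightarrow> \<xi> y = 0 \<or> (\<exists>\<eta>\<in>S. \<xi> y \<le> \<eta> y)" for S \<xi> x
  proof -
    \<comment> \<open>Cocontinuity speaks of index sets of natural numbers, so \<open>S\<close> is
      enumerated; with all weights 1 the colimit is the supremum of \<open>S\<close>.\<close>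
    obtain n :: nat and h where S_eq: "S = h ` {i. i < n}"
      using finite_imp_nat_seg_image_inj_on[OF S(1)] by blast
    let ?I = "{i. i < n}"
    let ?\<sigma> = "\<lambda>y\<in>topspace Y. unit_Sup ((\<lambda>i. T (h i y) 1) ` ?I)"
    have h: "h i \<in> C_set Y" if "i \<in> ?I" for i using S(2) S_eq that by blast
    have I: "finite ?I" by simp
    have \<sigma>: "?\<sigma> \<in> C_set Y"
      by (rule C_set_weighted_Sup[OF T I h]) auto
    have "\<xi> y \<le> ?\<sigma> y" if y: "y \<in> topspace Y" for y
    proof -
      let ?A = "(\<lambda>i. T (h i y) 1) ` ?I"
      have A: "?A = (\<lambda>\<eta>. \<eta> y) ` S"
        unfolding S_eq image_image
        by (rule image_cong[OF refl]) (simp only: t_norm_one_right[OF T C_set_mem[OF h y]])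
      have s: "?A \<subseteq> {0..1}" unfolding A using S(2) C_set_mem[OF _ y] by blast
      have "0 \<le> unit_Sup ?A" using unit_Sup_mem[OF s] by simp
      moreover have "\<eta> y \<le> unit_Sup ?A" if "\<eta> \<in> S" for \<eta>
        using unit_Sup_le_iff[OF s \<open>0 \<le> unit_Sup ?A\<close>] that unfolding A by blast
      ultimately show ?thesis using le[OF y] y by (auto intro: order_trans)
    qed
    then have "F \<xi> x \<le> F ?\<sigma> x" using mono[OF \<xi> \<sigma> _ x] by blast
    also have "F ?\<sigma> x = unit_Sup ((\<lambda>i. T (F (h i) x) 1) ` ?I)"
      using col[where h = h and w = "\<lambda>_. 1", OF I h] x by simp
    also have "\<dots> = unit_Sup ((\<lambda>\<eta>. F \<eta> x) ` S)"
      unfolding S_eq image_image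
      by (rule arg_cong[where f = unit_Sup], rule image_cong[OF refl])
        (simp only: t_norm_one_right[OF T C_set_mem[OF mem[OF h] x]])
    finally have "F \<xi> x \<le> unit_Sup ((\<lambda>\<eta>. F \<eta> x) ` S)" .
    \<comment> \<open>The finite supremum is attained by one member of \<open>S\<close>, or else it
      is 0.\<close>
    moreover have "unit_Sup ((\<lambda>\<eta>. F \<eta> x) ` S) \<in> insert 0 ((\<lambda>\<eta>. F \<eta> x) ` S)"
      using S(1) by (intro unit_Sup_finite_mem) simp
    ultimately show ?thesis using C_set_mem[OF mem[OF \<xi>] x] by force
  qed
  have "\<exists>y\<in>topspace Y. \<forall>\<psi>\<in>C_set Y. F \<psi> x = \<psi> y" if x: "x \<in> topspace X" for x
  proof (rule functional_is_evaluation[OF T Y, of "\<lambda>\<psi>. F \<psi> x"])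
    show "F \<psi> x \<in> {0..1}" if "\<psi> \<in> C_set Y" for \<psi> by (rule C_set_mem[OF mem[OF that] x])
    show "F (\<lambda>y\<in>topspace Y. c) x = c" if "c \<in> {0..1}" for c by (rule const[OF that x])
    show "F (\<lambda>y\<in>topspace Y. T (\<psi> y) (\<eta> y)) x = T (F \<psi> x) (F \<eta> x)"
      if "\<psi> \<in> C_set Y" "\<eta> \<in> C_set Y" for \<psi> \<eta>
      using mult[OF that] x by simp
    show "F \<xi> x = 0 \<or> (\<exists>\<eta>\<in>S. F \<xi> x \<le> F \<eta> x)"
      if "finite S" "S \<subseteq> C_set Y" "\<xi> \<in> C_set Y"
        "\<And>y. y \<in> topspace Y \<Longrightarrow> \<xi> y = 0 \<or> (\<exists>\<eta>\<in>S. \<xi> y \<le> \<eta> y)" for S \<xi>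
      by (rule sup[OF that(1-3) x that(4)])
  qed blast
  then obtain k where k: "\<And>x. x \<in> topspace X \<Longrightarrow> k x \<in> topspace Y"
      "\<And>x \<psi>. x \<in> topspace X \<Longrightarrow> \<psi> \<in> C_set Y \<Longrightarrow> F \<psi> x = \<psi> (k x)"
    by metis
  have "openin X {x \<in> topspace X. k x \<in> V}" if V: "openin Y V" for V
  proof (subst openin_subopen, intro ballI)
    fix x assume x: "x \<in> {x \<in> topspace X. k x \<in> V}"
    then obtain \<eta> where \<eta>: "\<eta> \<in> C_set Y" "\<eta> (k x) = 1" "\<And>z. z \<in> topspace Y \<Longrightarrow> z \<notin> V \<Longrightarrow> \<eta> z = 0"
      using C_set_separates[OF Y V] by blast
    \<comment> \<open>Since \<open>F \<eta> z = \<eta> (k z)\<close> and \<open>\<eta>\<close>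
      vanishes off \<open>V\<close>, positivity of \<open>F \<eta>\<close> at \<open>z\<close>
      forces \<open>k z\<close> into \<open>V\<close>.\<close>
    have "openin X {z \<in> topspace X. F \<eta> z \<in> {0<..}}"
      by (rule openin_continuous_map_preimage[of X euclideanreal])
        (use mem[OF \<eta>(1)] in \<open>auto simp: C_set_iff\<close>)
    moreover have "x \<in> {z \<in> topspace X. F \<eta> z \<in> {0<..}}" using x k(2)[OF _ \<eta>(1)] \<eta>(2) by simp
    moreover have "{z \<in> topspace X. F \<eta> z \<in> {0<..}} \<subseteq> {x \<in> topspace X. k x \<in> V}"
      using k(1) k(2)[OF _ \<eta>(1)] \<eta>(3) by force
    ultimately show "\<exists>U. openin X U \<and> x \<in> U \<and> U \<subseteq> {x \<in> topspace X. k x \<in> V}" by blast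
  qed
  then have "continuous_map X Y k" using k(1) by (auto simp: continuous_map_def)
  \<comment> \<open>The choice function \<open>k\<close> is arbitrary outside \<open>X\<close>,
    whereas morphisms are extensional.\<close>
  then have f: "restrict k (topspace X) \<in> comphaus_hom X Y"
    by (auto simp: comphaus_hom_def intro: continuous_map_eq)
  have "F = C_map X Y (restrict k (topspace X))"
  proof (rule extensionalityI[OF ext])
    show "C_map X Y (restrict k (topspace X)) \<in> extensional (C_set Y)" by (simp add: C_map_def)
    fix \<psi> assume \<psi>: "\<psi> \<in> C_set Y"
    show "F \<psi> = C_map X Y (restrict k (topspace X)) \<psi>"
      by (rule C_set_eqI[OF mem[OF \<psi>] C_map_mem[OF f \<psi>]]) (simp add: C_map_apply \<psi> k(2))
  qed
  then show ?thesis using that f by blast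
qed

theorem theorem6p22:
  fixes T :: "real \<Rightarrow> real \<Rightarrow> real"
    and X :: "'a topology" and Y :: "'b topology" and Z :: "'c topology"
  assumes "continuous_t_norm T"
    and "compact_space X" "Hausdorff_space X"
    and "compact_space Y" "Hausdorff_space Y"
    and "compact_space Z" "Hausdorff_space Z"
  shows "mon_finsup_object T (C_obj T X) \<and>
    (\<forall>f \<in> comphaus_hom X Y. C_map X Y f \<in> mon_finsup_hom T (C_obj T Y) (C_obj T X)) \<and>
    C_map X X (\<lambda>x\<in>topspace X. x) = (\<lambda>\<psi>\<in>carrier (C_obj T X). \<psi>) \<and>
    (\<forall>f \<in> comphaus_hom X Y. \<forall>g \<in> comphaus_hom Y Z.
       C_map X Z (compose (topspace X) g f) =
       compose (carrier (C_obj T Z)) (C_map X Y f) (C_map Y Z g)) \<and>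
    bij_betw (C_map X Y) (comphaus_hom X Y) (mon_finsup_hom T (C_obj T Y) (C_obj T X))"
proof (intro conjI ballI)
  note T = assms(1)
  show "mon_finsup_object T (C_obj T X)" by (rule mon_finsup_object_C_obj[OF T])
  show "C_map X Y f \<in> mon_finsup_hom T (C_obj T Y) (C_obj T X)" if "f \<in> comphaus_hom X Y" for f
    by (rule C_map_hom[OF T that])
  show "C_map X X (\<lambda>x\<in>topspace X. x) = (\<lambda>\<psi>\<in>carrier (C_obj T X). \<psi>)" by (simp add: C_map_id)
  show "C_map X Z (compose (topspace X) g f) =
      compose (carrier (C_obj T Z)) (C_map X Y f) (C_map Y Z g)"
    if "f \<in> comphaus_hom X Y" "g \<in> comphaus_hom Y Z" for f g
    by (simp add: C_map_compose[OF that])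
  \<comment> \<open>Injectivity is faithfulness; surjectivity, shown next, is fullness.\<close>
  have "inj_on (C_map X Y) (comphaus_hom X Y)"
    by (rule inj_onI) (rule C_map_inj[OF assms(4,5)])
  moreover have "C_map X Y ` comphaus_hom X Y = mon_finsup_hom T (C_obj T Y) (C_obj T X)"
  proof (intro subset_antisym subsetI)
    show "F \<in> C_map X Y ` comphaus_hom X Y" if "F \<in> mon_finsup_hom T (C_obj T Y) (C_obj T X)" for F
      by (rule C_hom_eq_C_map[OF T assms(4,5) that]) blast
  qed (use C_map_hom[OF T] in blast)
  ultimately show "bij_betw (C_map X Y) (comphaus_hom X Y) (mon_finsup_hom T (C_obj T Y) (C_obj T X))"
    by (simp add: bij_betw_def)
qed

end
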